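(* Let $D\subset\mathbb{R}^d$ be a nonempty compact set with $D=\overline{D^\circ}$ and $\mu_d(\partial D)=0$. Let $\mathcal{F}=\{f_1,\ldots,f_k\}$ be an iterated function system of injective contractions on $\mathbb{R}^d$, with attractor $E$. Suppose that $\mathcal{F}$ is a non-overlapping inside family with respect to $D$. Then $\mathcal{F}$ admits a dissection of $D$ if and only if $\mu_d(E)=0$. Moreover, the generator of the dissection is unique.
   Context: $\mu_d$ is $d$-dimensional Lebesgue measure; $X^\circ,\overline X,\partial X$ denote interior, closure and boundary. An iterated function system (IFS) is a finite family $\mathcal{F}=\{f_1,\ldots,f_k\}$ of contractions $\mathbb{R}^d\to\mathbb{R}^d$; its attractor is the unique nonempty compact set $E$ with $E=\bigcup_{i=1}^k f_i(E)$. $\mathcal{F}$ is an inside family with respect to $D$ if $f_i(D)\subset D$ for each $i\in\{1,\ldots,k\}$. $\mathcal{F}$ is a non-overlapping family with respect to $D$ if $\mu_d(f_i(D)\cap f_j(D))=0$ for all $i\neq j$ in $\{1,\ldots,k\}$. A finite family $\mathcal{F}=\{f_1,\ldots,f_k\}$ of injective maps $\mathbb{R}^d\to\mathbb{R}^d$ admits a dissection of $D$ if there exists a compact set $X\subset\mathbb{R}^d$ with $\overline{X^\circ}=X$ such that $D=X\cup f_1(X)\cup\cdots\cup f_k(X)$, where $\mu_d(f_i(X)\cap f_j(X))=0$ for all distinct $i,j\in\{1,\ldots,k\}$ and $\mu_d(X\cap f_i(X))=0$ for each $i\in\{1,\ldots,k\}$. Such an $X$ is called the generator of the dissection. *)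

theory Defs
  imports "HOL-Analysis.Analysis"
begin

text \<open>
  A finite family \<open>f\<^sub>1, \<dots>, f\<^sub>k\<close> of self-maps of a space is a function \<open>f\<close> on \<open>nat\<close>
  of which only the values at the indices \<open>1, \<dots>, k\<close> matter.
\<close>

definition contraction :: "('a::metric_space \<Rightarrow> 'a) \<Rightarrow> bool" where
  "contraction g \<longleftrightarrow> (\<exists>c<1. c-lipschitz_on UNIV g)"

definition is_ifs :: "nat \<Rightarrow> (nat \<Rightarrow> real^'n \<Rightarrow> real^'n) \<Rightarrow> bool" where
  "is_ifs k f \<longleftrightarrow> 1 \<le> k \<and> (\<forall>i\<in>{1..k}. contraction (f i))"

text \<open>
  For an iterated function system there is exactly one such set (Hutchinson), so
  \<open>is_attractor k f E\<close> says that \<open>E\<close> is the attractor.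
\<close>

definition is_attractor :: "nat \<Rightarrow> (nat \<Rightarrow> real^'n \<Rightarrow> real^'n) \<Rightarrow> (real^'n) set \<Rightarrow> bool" where
  "is_attractor k f E \<longleftrightarrow> compact E \<and> E \<noteq> {} \<and> E = (\<Union>i\<in>{1..k}. f i ` E)"

definition inside_family :: "nat \<Rightarrow> (nat \<Rightarrow> real^'n \<Rightarrow> real^'n) \<Rightarrow> (real^'n) set \<Rightarrow> bool" where
  "inside_family k f D \<longleftrightarrow> (\<forall>i\<in>{1..k}. f i ` D \<subseteq> D)"

text \<open>
  Having measure zero is expressed by membership in \<open>null_sets lebesgue\<close>, because
  \<open>emeasure\<close> is also \<open>0\<close> on sets that are not measurable.
\<close>

definition nonoverlapping_family ::
    "nat \<Rightarrow> (nat \<Rightarrow> real^'n \<Rightarrow> real^'n) \<Rightarrow> (real^'n) set \<Rightarrow> bool" where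
  "nonoverlapping_family k f D \<longleftrightarrow>
     (\<forall>i\<in>{1..k}. \<forall>j\<in>{1..k}. i \<noteq> j \<longrightarrow> f i ` D \<inter> f j ` D \<in> null_sets lebesgue)"

definition dissection_generator ::
    "nat \<Rightarrow> (nat \<Rightarrow> real^'n \<Rightarrow> real^'n) \<Rightarrow> (real^'n) set \<Rightarrow> (real^'n) set \<Rightarrow> bool" where
  "dissection_generator k f D X \<longleftrightarrow>
     compact X \<and> closure (interior X) = X \<and>
     D = X \<union> (\<Union>i\<in>{1..k}. f i ` X) \<and>
     (\<forall>i\<in>{1..k}. \<forall>j\<in>{1..k}. i \<noteq> j \<longrightarrow> f i ` X \<inter> f j ` X \<in> null_sets lebesgue) \<and>
     (\<forall>i\<in>{1..k}. X \<inter> f i ` X \<in> null_sets lebesgue)"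

definition admits_dissection ::
    "nat \<Rightarrow> (nat \<Rightarrow> real^'n \<Rightarrow> real^'n) \<Rightarrow> (real^'n) set \<Rightarrow> bool" where
  "admits_dissection k f D \<longleftrightarrow> (\<exists>X. dissection_generator k f D X)"

end

theory Submission
  imports Defs
begin

text \<open>
  Write \<open>F A = f\<^sub>1(A) \<union> \<dots> \<union> f\<^sub>k(A)\<close> for the Hutchinson operator. Iterating it on \<open>D\<close> peels
  \<open>D\<close> into layers: the difference of \<open>F\<^sup>n D\<close> and \<open>F\<^sup>n\<^sup>+\<^sup>1 D\<close> lies in \<open>F\<^sup>n (D - F D)\<close>, and what
  survives all iterations is the attractor \<open>E\<close>. A generator \<open>X\<close> has to satisfy
  \<open>D = X \<union> F X\<close> with null overlap. As \<open>F X \<subseteq> F D\<close>, the outermost layer \<open>D - F D\<close> has to belong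
  to \<open>X\<close>, its image to \<open>F X\<close> and thus not to \<open>X\<close>, and so on: \<open>X\<close> consists of the even layers
  and \<open>F X\<close> of the odd ones.

  If \<open>E\<close> is null, this recipe works. With \<open>core = interior D - F D\<close>, let \<open>X\<close> be the closure of
  \<open>\<Union>n. F\<^sup>2\<^sup>n core\<close>. By invariance of domain the union is open, so \<open>X\<close> is regular closed. The
  layers cover \<open>D - E\<close>, which is dense in \<open>D\<close> because \<open>E\<close> is null and \<open>D\<close> is regular closed;
  hence \<open>X \<union> F X = D\<close> (\<open>cover_even_layers\<close>). Taking the closure adds to the layers only
  their own boundaries and points of \<open>E\<close>, and two different closed layers meet in a null set
  because \<open>closure core\<close> meets \<open>F D\<close> only in the null set \<open>frontier (F D)\<close>; hence
  \<open>X \<inter> F X\<close> is null (\<open>negligible_even_layers_Int\<close>).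

  Conversely, let \<open>X\<close> be any generator. An open set that meets \<open>F X\<close> in a null set misses it
  (\<open>disjoint_of_negligible_Int\<close>), so the null overlap of \<open>F X\<close> and \<open>F (F X)\<close> gives
  \<open>F (F X) \<subseteq> X\<close>. A nonempty compact set mapped into itself by a power of \<open>F\<close> contains the
  attractor. Therefore \<open>E \<subseteq> X\<close>, also \<open>E = F E \<subseteq> F X\<close>, and \<open>E\<close> lies in the null set
  \<open>X \<inter> F X\<close>. The same inclusion \<open>F (F X) \<subseteq> X\<close> puts all even layers into \<open>X\<close>, and since
  the even layers together with their image already fill \<open>D\<close>, nothing else fits into the
  interior of \<open>X\<close> (\<open>generator_unique\<close>).
\<close>

section \<open>Negligible sets, open maps and closures\<close>

lemma open_negligible_empty:
  fixes S :: "'a::euclidean_space set"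
  assumes "open S" and "negligible S"
  shows "S = {}"
  using assms open_not_negligible by blast

lemma open_subset_closure_diff_negligible:
  fixes V :: "'a::euclidean_space set"
  assumes "open V" and "negligible N"
  shows "V \<subseteq> closure (V - N)"
proof -
  have "V - closure (V - N) \<subseteq> N"
    using closure_subset[of "V - N"] by blast
  then have "negligible (V - closure (V - N))"
    using assms(2) negligible_subset by blast
  moreover have "open (V - closure (V - N))"
    using assms(1) by (simp add: open_Diff)
  ultimately show ?thesis
    using open_negligible_empty by blast
qed

text \<open>
  Lipschitz maps preserve null sets. Inverses of the maps need not be Lipschitz, so the whole
  argument transports null sets forwards only.
\<close>

lemma negligible_contraction_image:
  fixes g :: "'a::euclidean_space \<Rightarrow> 'a"
  assumes "contraction g" and "negligible S"
  shows "negligible (g ` S)"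
proof -
  obtain c where c: "c-lipschitz_on UNIV g"
    using assms(1) unfolding contraction_def by blast
  have "\<exists>T B. open T \<and> x \<in> T \<and> (\<forall>y\<in>S \<inter> T. norm (g y - g x) \<le> B * norm (y - x))" for x
    using lipschitz_onD[OF c, of _ x] by (intro exI[of _ UNIV] exI[of _ c]) (auto simp: dist_norm)
  then show ?thesis
    using negligible_locally_Lipschitz_image[OF _ assms(2), of g] by simp
qed

lemma contraction_continuous: "contraction g \<Longrightarrow> continuous_on S g"
  unfolding contraction_def
  using lipschitz_on_continuous_on continuous_on_subset by blast

section \<open>The Hutchinson operator\<close>

definition hutchinson :: "nat \<Rightarrow> (nat \<Rightarrow> 'a \<Rightarrow> 'a) \<Rightarrow> 'a set \<Rightarrow> 'a set" where
  "hutchinson k f A = (\<Union>i\<in>{1..k}. f i ` A)"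

lemma hutchinson_mono: "A \<subseteq> B \<Longrightarrow> hutchinson k f A \<subseteq> hutchinson k f B"
  unfolding hutchinson_def by blast

lemma hutchinson_pow_mono: "A \<subseteq> B \<Longrightarrow> (hutchinson k f ^^ n) A \<subseteq> (hutchinson k f ^^ n) B"
  by (induction n) (auto dest: hutchinson_mono)

lemma hutchinson_UN: "hutchinson k f (\<Union>n. A n) = (\<Union>n. hutchinson k f (A n))"
  unfolding hutchinson_def by blast

lemma hutchinson_Un: "hutchinson k f (A \<union> B) = hutchinson k f A \<union> hutchinson k f B"
  unfolding hutchinson_def by blast

text \<open>
  For \<open>B = F A\<close> this places the part of \<open>A\<close> lost at step \<open>n\<close> in the \<open>n\<close>-th image of
  the part lost at the first step.
\<close>

lemma hutchinson_pow_diff: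
  "(hutchinson k f ^^ n) A - (hutchinson k f ^^ n) B \<subseteq> (hutchinson k f ^^ n) (A - B)"
proof (induction n)
  case (Suc n)
  have "hutchinson k f A' - hutchinson k f B' \<subseteq> hutchinson k f (A' - B')" for A' B' :: "'a set"
    unfolding hutchinson_def by blast
  then show ?case
    using Suc hutchinson_mono by fastforce
qed simp

lemma hutchinson_pow_invariant:
  "hutchinson k f A \<subseteq> A \<Longrightarrow> (hutchinson k f ^^ n) A \<subseteq> A"
  by (induction n) (use hutchinson_mono in fastforce)+

lemma hutchinson_pow_antimono:
  assumes "hutchinson k f A \<subseteq> A" and "m \<le> n"
  shows "(hutchinson k f ^^ n) A \<subseteq> (hutchinson k f ^^ m) A"
proof -
  have "(hutchinson k f ^^ m) ((hutchinson k f ^^ (n - m)) A) \<subseteq> (hutchinson k f ^^ m) A"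
    using hutchinson_pow_invariant[OF assms(1)] hutchinson_pow_mono by blast
  then show ?thesis
    using assms(2) by (metis comp_apply funpow_add le_add_diff_inverse)
qed

locale injective_ifs =
  fixes k :: nat and f :: "nat \<Rightarrow> 'a::euclidean_space \<Rightarrow> 'a"
  assumes contraction: "i \<in> {1..k} \<Longrightarrow> contraction (f i)"
    and inj: "i \<in> {1..k} \<Longrightarrow> inj (f i)"
begin

abbreviation F where "F \<equiv> hutchinson k f"

lemma continuous: "i \<in> {1..k} \<Longrightarrow> continuous_on S (f i)"
  using contraction contraction_continuous by blast

lemma open_image: "i \<in> {1..k} \<Longrightarrow> open U \<Longrightarrow> open (f i ` U)"
  using continuous inj invariance_of_domain inj_on_subset by blast

lemma open_hutchinson: "open U \<Longrightarrow> open (F U)"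
  unfolding hutchinson_def using open_image by blast

lemma open_hutchinson_pow: "open U \<Longrightarrow> open ((F ^^ n) U)"
  by (induction n) (auto intro: open_hutchinson)

lemma compact_hutchinson: "compact A \<Longrightarrow> compact (F A)"
  unfolding hutchinson_def
  by (intro compact_UN finite_atLeastAtMost compact_continuous_image continuous)

lemma closed_hutchinson: "compact A \<Longrightarrow> closed (F A)"
  using compact_hutchinson compact_imp_closed by blast

lemma negligible_hutchinson: "negligible A \<Longrightarrow> negligible (F A)"
  unfolding hutchinson_def
  by (intro negligible_Union) (use contraction negligible_contraction_image in blast)+

lemma compact_hutchinson_pow: "compact A \<Longrightarrow> compact ((F ^^ n) A)"
  by (induction n) (auto intro: compact_hutchinson)

lemma hutchinson_closure: "F (closure A) \<subseteq> closure (F A)"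
proof -
  have "f i ` closure A \<subseteq> closure (F A)" if "i \<in> {1..k}" for i
  proof (rule image_closure_subset)
    show "f i ` A \<subseteq> closure (F A)"
      using that closure_subset[of "F A"] unfolding hutchinson_def by blast
  qed (use that continuous in auto)
  then show ?thesis
    unfolding hutchinson_def[of k f "closure A"] by blast
qed

lemma hutchinson_pow_closure: "(F ^^ n) (closure A) \<subseteq> closure ((F ^^ n) A)"
proof (induction n)
  case (Suc n)
  then have "F ((F ^^ n) (closure A)) \<subseteq> F (closure ((F ^^ n) A))"
    by (rule hutchinson_mono)
  then show ?case
    using hutchinson_closure[of "(F ^^ n) A"] by simp
qed simp

text \<open>
  The image of the interior is open by invariance of domain, so only boundary points of \<open>D\<close> can
  be mapped to the boundary of the image.
\<close>

lemma frontier_image: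
  assumes "i \<in> {1..k}" and "compact D"
  shows "frontier (f i ` D) \<subseteq> f i ` frontier D"
proof -
  have "closed (f i ` D)"
    using assms by (intro compact_imp_closed compact_continuous_image continuous)
  moreover have "f i ` interior D \<subseteq> interior (f i ` D)"
    using assms(1) interior_subset by (intro interior_maximal open_image) blast+
  ultimately have "frontier (f i ` D) \<subseteq> f i ` D - f i ` interior D"
    unfolding frontier_def by auto
  also have "\<dots> \<subseteq> f i ` frontier D"
    using closure_subset unfolding frontier_def by blast
  finally show ?thesis .
qed

lemma negligible_frontier_hutchinson:
  assumes "compact D" and "negligible (frontier D)"
  shows "negligible (frontier (F D))"
proof -
  have "frontier (F D) \<subseteq> (\<Union>i\<in>{1..k}. frontier (f i ` D))"
  proof
    fix x assume "x \<in> frontier (F D)"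
    then have x: "x \<in> F D" "x \<notin> interior (F D)"
      using closed_hutchinson[OF assms(1)] unfolding frontier_def by auto
    then obtain i where i: "i \<in> {1..k}" "x \<in> f i ` D"
      unfolding hutchinson_def by blast
    have "interior (f i ` D) \<subseteq> interior (F D)"
      using i(1) by (intro interior_mono) (auto simp: hutchinson_def)
    then have "x \<in> frontier (f i ` D)"
      using x(2) i(2) closure_subset unfolding frontier_def by blast
    then show "x \<in> (\<Union>i\<in>{1..k}. frontier (f i ` D))"
      using i(1) by blast
  qed
  also have "\<dots> \<subseteq> F (frontier D)"
    using frontier_image[OF _ assms(1)] unfolding hutchinson_def by blast
  finally have "frontier (F D) \<subseteq> F (frontier D)" .
  then show ?thesis
    using assms(2) negligible_hutchinson negligible_subset by blast
qed

lemma uniform_ratio: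
  obtains c where "0 \<le> c" "c < 1" "\<And>i x y. i \<in> {1..k} \<Longrightarrow> dist (f i x) (f i y) \<le> c * dist x y"
proof -
  have "\<forall>i\<in>{1..k}. \<exists>c<1. c-lipschitz_on UNIV (f i)"
    using contraction unfolding contraction_def by blast
  then obtain r where r: "\<And>i. i \<in> {1..k} \<Longrightarrow> r i < 1 \<and> (r i)-lipschitz_on UNIV (f i)"
    by metis
  \<comment> \<open>inserting \<open>0\<close> makes the maximum meaningful and nonnegative even for \<open>k = 0\<close>\<close>
  define c where "c = Max (insert 0 (r ` {1..k}))"
  have "0 \<le> c" "c < 1"
    unfolding c_def using r by auto
  moreover have "dist (f i x) (f i y) \<le> c * dist x y" if "i \<in> {1..k}" for i x y
  proof -
    have "dist (f i x) (f i y) \<le> r i * dist x y"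
      using r[OF that] lipschitz_onD by blast
    also have "\<dots> \<le> c * dist x y"
      unfolding c_def using that by (intro mult_right_mono[OF Max_ge] zero_le_dist finite_insert[THEN iffD2] finite_imageI) blast+
    finally show ?thesis .
  qed
  ultimately show thesis
    using that by blast
qed

text \<open>
  The distance is measured to the moving target \<open>(F ^^ n) B\<close>, so no invariance of \<open>B\<close> is
  assumed; this lets \<open>B\<close> later be invariant under some power of \<open>F\<close> rather than under \<open>F\<close> itself.
\<close>

lemma infdist_hutchinson_pow:
  assumes B: "compact B" "B \<noteq> {}"
    and c: "0 \<le> c" "\<And>i x y. i \<in> {1..k} \<Longrightarrow> dist (f i x) (f i y) \<le> c * dist x y"
    and M: "\<And>a. a \<in> A \<Longrightarrow> infdist a B \<le> M"
    and x: "x \<in> (F ^^ n) A"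
  shows "(F ^^ n) B \<noteq> {} \<and> infdist x ((F ^^ n) B) \<le> c ^ n * M"
  using x
proof (induction n arbitrary: x)
  case 0
  then show ?case using M B by simp
next
  case (Suc n)
  then obtain i y where i: "i \<in> {1..k}" and y: "y \<in> (F ^^ n) A" and x: "x = f i y"
    unfolding funpow.simps comp_apply hutchinson_def[of k f "(F ^^ n) A"] by blast
  let ?C = "(F ^^ n) B"
  have ne: "?C \<noteq> {}" and le: "infdist y ?C \<le> c ^ n * M"
    using Suc.IH[OF y] by auto
  have "closed ?C"
    using B(1) compact_hutchinson_pow compact_imp_closed by blast
  then obtain q where q: "q \<in> ?C" "infdist y ?C = dist y q"
    using ne infdist_attains_inf by blast
  have mem: "f i q \<in> F ?C"
    using q(1) i unfolding hutchinson_def by blast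
  then have "infdist x (F ?C) \<le> dist x (f i q)"
    by (rule infdist_le)
  also have "\<dots> \<le> c * dist y q"
    using c(2)[OF i] x by simp
  also have "\<dots> \<le> c * (c ^ n * M)"
    using le q(2) c(1) by (intro mult_left_mono) auto
  finally show ?case
    using mem by auto
qed

text \<open>
  Along multiples of \<open>p\<close> the iterates of \<open>B\<close> stay in \<open>B\<close>, while the iterates of \<open>A\<close>
  approach them geometrically; a point common to all iterates of \<open>A\<close> is thus at distance \<open>0\<close>
  from the closed set \<open>B\<close>. Taking \<open>B\<close> to be the attractor bounds \<open>\<Inter>n. F\<^sup>n A\<close> from above,
  and taking \<open>A\<close> to be the attractor bounds \<open>B\<close> from below.
\<close>

lemma forward_limit_subset:
  assumes B: "compact B" "B \<noteq> {}" and p: "0 < p" "(F ^^ p) B \<subseteq> B"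
    and A: "compact A"
  shows "(\<Inter>n. (F ^^ n) A) \<subseteq> B"
proof
  fix x assume x: "x \<in> (\<Inter>n. (F ^^ n) A)"
  obtain c where c: "0 \<le> c" "c < 1"
      "\<And>i x y. i \<in> {1..k} \<Longrightarrow> dist (f i x) (f i y) \<le> c * dist x y"
    using uniform_ratio by blast
  have "bounded ((\<lambda>a. infdist a B) ` A)"
    using A by (intro compact_imp_bounded compact_continuous_image continuous_intros)
  then obtain M where M: "\<And>a. a \<in> A \<Longrightarrow> infdist a B \<le> M"
    unfolding bounded_iff by (metis abs_le_D1 imageI real_norm_def)
  have inv: "(F ^^ (p * n)) B \<subseteq> B" for n
  proof (induction n)
    case (Suc n)
    have "(F ^^ (p * Suc n)) B = (F ^^ p) ((F ^^ (p * n)) B)"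
      by (simp add: funpow_add)
    then show ?case
      using order_trans[OF hutchinson_pow_mono[OF Suc] p(2)] by simp
  qed simp
  have "infdist x B \<le> (c ^ p) ^ n * M" for n
  proof -
    have "(F ^^ (p * n)) B \<noteq> {}" and "infdist x ((F ^^ (p * n)) B) \<le> c ^ (p * n) * M"
      using infdist_hutchinson_pow[OF B c(1,3) M, where n = "p * n" and x = x] x by blast+
    then show ?thesis
      using infdist_mono[OF inv[of n], of x] by (simp add: power_mult)
  qed
  moreover have "(\<lambda>n. (c ^ p) ^ n * M) \<longlonglongrightarrow> 0 * M"
    using c p(1) by (intro tendsto_mult LIMSEQ_realpow_zero tendsto_const)
      (auto simp: power_less_one_iff)
  ultimately have "infdist x B \<le> 0"
    by (intro LIMSEQ_le_const[of _ "0 * M" "infdist x B", simplified]) auto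
  then have "infdist x B = 0"
    using infdist_nonneg[of x B] by linarith
  then show "x \<in> B"
    using B in_closed_iff_infdist_zero compact_imp_closed by blast
qed

end

section \<open>Non-overlapping inside families\<close>

locale nonoverlapping_inside_ifs = injective_ifs k f
  for k :: nat and f :: "nat \<Rightarrow> real^'n \<Rightarrow> real^'n" +
  fixes D E :: "(real^'n) set"
  assumes compact_D: "compact D" and D_nonempty: "D \<noteq> {}"
    and regular_closed: "closure (interior D) = D"
    and frontier_D: "negligible (frontier D)"
    and inside: "F D \<subseteq> D"
    and nonoverlapping:
      "\<And>i j. i \<in> {1..k} \<Longrightarrow> j \<in> {1..k} \<Longrightarrow> i \<noteq> j \<Longrightarrow> negligible (f i ` D \<inter> f j ` D)"
    and compact_E: "compact E" and E_nonempty: "E \<noteq> {}" and attractor: "F E = E"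
begin

lemma attractor_pow: "(F ^^ n) E = E"
  by (induction n) (auto simp: attractor)

lemma attractor_subset:
  assumes "compact B" "B \<noteq> {}" "0 < p" "(F ^^ p) B \<subseteq> B"
  shows "E \<subseteq> B"
  using forward_limit_subset[OF assms compact_E] by (simp add: attractor_pow)

lemma outside_attractor:
  assumes "x \<notin> E"
  obtains n where "x \<notin> (F ^^ n) D"
  using forward_limit_subset[OF compact_E E_nonempty, of 1 D] compact_D attractor assms by auto

text \<open>
  Images under different maps overlap in a null set by the non-overlapping property of \<open>D\<close>; images
  under the same map meet, by injectivity, in the image of \<open>A \<inter> B\<close>. Working with the whole operator
  makes this iterable without any bookkeeping of words in the maps \<open>f i\<close>.
\<close>

lemma negligible_hutchinson_Int:
  assumes "A \<subseteq> D" "B \<subseteq> D" "negligible (A \<inter> B)"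
  shows "negligible (F A \<inter> F B)"
proof -
  let ?P = "{(i, j) \<in> {1..k} \<times> {1..k}. i \<noteq> j}"
  let ?N = "(\<Union>(i, j)\<in>?P. f i ` D \<inter> f j ` D) \<union> F (A \<inter> B)"
  have "F A \<inter> F B \<subseteq> ?N"
  proof
    fix x assume "x \<in> F A \<inter> F B"
    then obtain i j a b where ij: "i \<in> {1..k}" "j \<in> {1..k}"
      and ab: "a \<in> A" "b \<in> B" "x = f i a" "x = f j b"
      unfolding hutchinson_def by blast
    show "x \<in> ?N"
    proof (cases "i = j")
      case True
      then have "a = b" using ab inj[OF ij(1)] by (auto dest: injD)
      then show ?thesis using ab ij unfolding hutchinson_def by blast
    next
      case False
      moreover have "x \<in> f i ` D \<inter> f j ` D"
        using ab assms(1,2) by blast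
      ultimately have "x \<in> (\<Union>(i, j)\<in>?P. f i ` D \<inter> f j ` D)"
        using ij by blast
      then show ?thesis by blast
    qed
  qed
  moreover have "finite ?P"
    by (rule finite_subset[of _ "{1..k} \<times> {1..k}"]) auto
  then have "negligible (\<Union>(i, j)\<in>?P. f i ` D \<inter> f j ` D)"
    by (intro negligible_Union) (auto intro: nonoverlapping)
  moreover have "negligible (F (A \<inter> B))"
    using assms(3) by (rule negligible_hutchinson)
  ultimately show ?thesis
    using negligible_subset negligible_Un by blast
qed

lemma hutchinson_pow_subset: "A \<subseteq> D \<Longrightarrow> (F ^^ n) A \<subseteq> D"
  using hutchinson_pow_mono[of A D] hutchinson_pow_invariant[OF inside] by fast

lemma negligible_hutchinson_pow_Int:
  assumes "A \<subseteq> D" "B \<subseteq> D" "negligible (A \<inter> B)"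
  shows "negligible ((F ^^ n) A \<inter> (F ^^ n) B)"
proof (induction n)
  case (Suc n)
  then show ?case
    using assms(1,2) by (simp add: negligible_hutchinson_Int hutchinson_pow_subset)
qed (use assms in simp)

text \<open>
  The interior of \<open>D\<close> is used instead of \<open>D\<close> so that all layers are open; the closure of
  \<open>core\<close> contains the full difference \<open>D - F D\<close>.
\<close>

definition core where "core = interior D - F D"

definition even_layers where "even_layers = (\<Union>n. (F ^^ (2 * n)) core)"

lemma open_core: "open core"
  unfolding core_def
  using closed_hutchinson[OF compact_D] by (simp add: open_Diff)

lemma core_subset: "core \<subseteq> D"
  unfolding core_def using interior_subset by blast

lemma closure_core_subset: "closure core \<subseteq> D"
  using core_subset compact_D by (intro closure_minimal compact_imp_closed)

text \<open>
  The complement of \<open>F D\<close> is open and \<open>interior D\<close> is dense in \<open>D\<close>, so their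
  intersection is dense in \<open>D - F D\<close>.
\<close>

lemma diff_subset_closure_core: "D - F D \<subseteq> closure core"
proof -
  have "open (- F D)"
    using closed_hutchinson[OF compact_D] by (simp add: open_Compl)
  then have "- F D \<inter> closure (interior D) \<subseteq> closure (- F D \<inter> interior D)"
    by (rule open_Int_closure_subset)
  then show ?thesis
    unfolding core_def using regular_closed by (simp add: Diff_eq Int_commute)
qed

text \<open>
  As \<open>core\<close> misses \<open>F D\<close>, its closure misses the interior of \<open>F D\<close>, and so the two sets
  meet only in the frontier of \<open>F D\<close>, which is covered by images of the null set \<open>frontier D\<close>.
\<close>

lemma negligible_closure_core_Int: "negligible (closure core \<inter> F D)"
proof -
  have "interior (F D) \<inter> closure core = {}"
    unfolding core_def using interior_subset
    by (subst open_Int_closure_eq_empty) auto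
  then have "closure core \<inter> F D \<subseteq> frontier (F D)"
    using closure_subset unfolding frontier_def by blast
  then show ?thesis
    using negligible_frontier_hutchinson[OF compact_D frontier_D] negligible_subset by blast
qed

text \<open>
  Pulling out the common power of \<open>F\<close> reduces the claim to layer \<open>0\<close> against a later layer,
  and every later layer lies in \<open>F D\<close>.
\<close>

lemma negligible_layers_Int:
  assumes "m \<noteq> n"
  shows "negligible ((F ^^ m) (closure core) \<inter> (F ^^ n) (closure core))"
  using assms
proof (induction m n rule: linorder_wlog)
  case (le m n)
  define r where "r = n - Suc m"
  have r: "n = m + Suc r"
    unfolding r_def using le by simp
  let ?B = "(F ^^ Suc r) (closure core)"
  have "?B \<subseteq> (F ^^ Suc r) D"
    using closure_core_subset by (rule hutchinson_pow_mono)
  also have "\<dots> \<subseteq> F D"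
    using hutchinson_pow_antimono[OF inside, of 1 "Suc r"] by simp
  finally have B: "?B \<subseteq> F D" .
  then have "negligible (closure core \<inter> ?B)"
    by (intro negligible_subset[OF negligible_closure_core_Int]) blast
  then have "negligible ((F ^^ m) (closure core) \<inter> (F ^^ m) ?B)"
    using closure_core_subset order_trans[OF B inside] negligible_hutchinson_pow_Int by blast
  then show ?case
    unfolding r by (simp only: funpow_add comp_apply)
next
  case (sym m n)
  then show ?case
    using Int_commute by metis
qed

lemma even_layers_subset: "closure even_layers \<subseteq> D"
proof -
  have "even_layers \<subseteq> D"
    unfolding even_layers_def
    by (intro UN_least hutchinson_pow_subset core_subset)
  then show ?thesis
    using compact_D by (intro closure_minimal compact_imp_closed)
qed

lemma compact_closure_even_layers: "compact (closure even_layers)"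
  using compact_Int_closed[OF compact_D closed_closure, of even_layers] even_layers_subset
  by (simp add: Int_absorb1)

text \<open>
  Layers accumulate only at the attractor: near a point outside \<open>(F ^^ N) D\<close> there are at
  most \<open>N\<close> even layers, and the closure of a finite union is harmless.
\<close>

lemma closure_even_layers_subset: "closure even_layers \<subseteq> (\<Union>n. (F ^^ (2 * n)) (closure core)) \<union> E"
proof
  fix x assume x: "x \<in> closure even_layers"
  show "x \<in> (\<Union>n. (F ^^ (2 * n)) (closure core)) \<union> E"
  proof (cases "x \<in> E")
    case False
    then obtain N where N: "x \<notin> (F ^^ N) D"
      using outside_attractor by blast
    \<comment> \<open>a compact set containing all even layers: those before \<open>N\<close>, and \<open>(F ^^ N) D\<close> for the rest\<close>
    let ?K = "(\<Union>n<N. (F ^^ (2 * n)) (closure core)) \<union> (F ^^ N) D"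
    have "(F ^^ (2 * n)) core \<subseteq> ?K" for n
    proof (cases "n < N")
      case True
      then show ?thesis
        using hutchinson_pow_mono[OF closure_subset[of core], where n = "2 * n"] by blast
    next
      case False
      have "(F ^^ (2 * n)) core \<subseteq> (F ^^ (2 * n)) D"
        by (intro hutchinson_pow_mono core_subset)
      also have "\<dots> \<subseteq> (F ^^ N) D"
        using False by (intro hutchinson_pow_antimono inside) simp
      finally show ?thesis by blast
    qed
    moreover have "compact (closure core)"
      using compact_Int_closed[OF compact_D closed_closure, of core] closure_core_subset
      by (simp add: Int_absorb1)
    then have "compact ?K"
      using compact_D by (intro compact_Un compact_UN compact_hutchinson_pow) auto
    ultimately have "closure even_layers \<subseteq> ?K"
      unfolding even_layers_def by (intro closure_minimal compact_imp_closed) blast+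
    then show ?thesis
      using x N by blast
  qed blast
qed

text \<open>
  Outside \<open>E\<close> only closed even layers can meet closed odd layers, and there are countably many such
  pairs, each with a null intersection.
\<close>

lemma negligible_even_layers_Int:
  assumes "negligible E"
  shows "negligible (closure even_layers \<inter> F (closure even_layers))"
proof -
  let ?even = "\<lambda>n. (F ^^ (2 * n)) (closure core)" and ?odd = "\<lambda>n. (F ^^ Suc (2 * n)) (closure core)"
  have "F (closure even_layers) \<subseteq> F ((\<Union>n. ?even n) \<union> E)"
    using closure_even_layers_subset by (rule hutchinson_mono)
  also have "\<dots> = (\<Union>n. ?odd n) \<union> E"
    by (simp add: hutchinson_Un hutchinson_UN attractor)
  finally have "closure even_layers \<inter> F (closure even_layers)
      \<subseteq> ((\<Union>m. ?even m) \<union> E) \<inter> ((\<Union>n. ?odd n) \<union> E)"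
    by (intro Int_mono closure_even_layers_subset)
  also have "\<dots> \<subseteq> (\<Union>m. \<Union>n. ?even m \<inter> ?odd n) \<union> E"
    by auto
  finally have "closure even_layers \<inter> F (closure even_layers) \<subseteq> (\<Union>m. \<Union>n. ?even m \<inter> ?odd n) \<union> E" .
  moreover have "negligible (?even m \<inter> ?odd n)" for m n
    by (intro negligible_layers_Int) presburger
  then have "negligible (\<Union>m. \<Union>n. ?even m \<inter> ?odd n)"
    by (intro negligible_Union_nat)
  ultimately show ?thesis
    using assms negligible_Un negligible_subset by blast
qed

text \<open>
  A point outside \<open>E\<close> leaves the decreasing sequence \<open>F\<^sup>n D\<close> at some step, and the parity of
  that step decides whether it belongs to the even layers or to their image.
\<close>

lemma diff_attractor_subset: "D - E \<subseteq> closure even_layers \<union> F (closure even_layers)"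
proof
  fix x assume x: "x \<in> D - E"
  then obtain N where "x \<notin> (F ^^ N) D"
    using outside_attractor by blast
  then have "\<exists>n. x \<in> (F ^^ n) D \<and> x \<notin> (F ^^ Suc n) D"
  proof (induction N)
    case 0
    then show ?case using x by simp
  qed blast
  then obtain n where "x \<in> (F ^^ n) D - (F ^^ n) (F D)"
    by (auto simp: funpow_swap1)
  then have "x \<in> (F ^^ n) (D - F D)"
    by (rule subsetD[OF hutchinson_pow_diff])
  then have n: "x \<in> (F ^^ n) (closure core)"
    by (rule subsetD[OF hutchinson_pow_mono[OF diff_subset_closure_core]])
  have even: "(F ^^ (2 * m)) (closure core) \<subseteq> closure even_layers" for m
  proof -
    have "(F ^^ (2 * m)) (closure core) \<subseteq> closure ((F ^^ (2 * m)) core)"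
      by (rule hutchinson_pow_closure)
    also have "\<dots> \<subseteq> closure even_layers"
      unfolding even_layers_def by (intro closure_mono) blast
    finally show ?thesis .
  qed
  show "x \<in> closure even_layers \<union> F (closure even_layers)"
  proof (cases "even n")
    case True
    then show ?thesis using n even by (auto elim!: evenE)
  next
    case False
    then obtain m where "n = Suc (2 * m)" by (auto elim!: oddE)
    then show ?thesis using n hutchinson_mono[OF even[of m], of k f] by auto
  qed
qed

text \<open>
  Since \<open>E\<close> is null, \<open>interior D - E\<close> is dense in \<open>D\<close>, and a
  closed set containing it contains \<open>D\<close>.
\<close>

lemma cover_even_layers:
  assumes "negligible E"
  shows "D \<subseteq> closure even_layers \<union> F (closure even_layers)" (is "_ \<subseteq> ?R")
proof -
  have "closed ?R"
    by (intro compact_imp_closed compact_Un compact_hutchinson compact_closure_even_layers)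
  moreover have "interior D - E \<subseteq> ?R"
    using diff_attractor_subset interior_subset by blast
  ultimately have "closure (interior D - E) \<subseteq> ?R"
    by (rule closure_minimal[rotated])
  moreover have "interior D \<subseteq> closure (interior D - E)"
    by (intro open_subset_closure_diff_negligible assms open_interior)
  then have "closure (interior D) \<subseteq> closure (interior D - E)"
    by (intro closure_minimal) auto
  ultimately show ?thesis
    using regular_closed by blast
qed

text \<open>
  The pairwise conditions on \<open>f i ` X\<close> follow from \<open>X \<subseteq> D\<close> and the non-overlapping of \<open>D\<close>,
  so a generator can be described through the operator \<open>F\<close> alone.
\<close>

lemma generator_iff:
  "dissection_generator k f D X \<longleftrightarrow>
     compact X \<and> closure (interior X) = X \<and> D = X \<union> F X \<and> negligible (X \<inter> F X)"
  (is "?L \<longleftrightarrow> ?R")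
proof
  assume L: ?L
  have "X \<inter> F X = (\<Union>i\<in>{1..k}. X \<inter> f i ` X)"
    unfolding hutchinson_def by blast
  moreover have "negligible (\<Union>i\<in>{1..k}. X \<inter> f i ` X)"
    using L unfolding dissection_generator_def
    by (intro negligible_Union) (auto simp: negligible_iff_null_sets)
  ultimately show ?R
    using L unfolding dissection_generator_def hutchinson_def by simp
next
  assume R: ?R
  then have "X \<subseteq> D" by blast
  have "negligible (f i ` X \<inter> f j ` X)" if "i \<in> {1..k}" "j \<in> {1..k}" "i \<noteq> j" for i j
    using \<open>X \<subseteq> D\<close> by (intro negligible_subset[OF nonoverlapping[OF that]]) blast
  moreover have "negligible (X \<inter> f i ` X)" if "i \<in> {1..k}" for i
  proof (rule negligible_subset)
    show "negligible (X \<inter> F X)"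
      using R by blast
    show "X \<inter> f i ` X \<subseteq> X \<inter> F X"
      using that unfolding hutchinson_def by blast
  qed
  ultimately show ?L
    using R unfolding dissection_generator_def negligible_iff_null_sets[symmetric]
    by (simp add: hutchinson_def)
qed

lemma even_layers_generator:
  assumes "negligible E"
  shows "dissection_generator k f D (closure even_layers)"
proof -
  have "open even_layers"
    unfolding even_layers_def by (intro open_UN ballI open_hutchinson_pow open_core)
  then have "even_layers \<subseteq> interior (closure even_layers)"
    by (intro interior_maximal closure_subset)
  then have "closure even_layers \<subseteq> closure (interior (closure even_layers))"
    by (rule closure_mono)
  moreover have "closure (interior (closure even_layers)) \<subseteq> closure even_layers"
    using closure_mono[OF interior_subset[of "closure even_layers"]] by simp
  moreover have "D = closure even_layers \<union> F (closure even_layers)"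
    using cover_even_layers[OF assms] even_layers_subset inside hutchinson_mono[OF even_layers_subset]
    by blast
  ultimately show ?thesis
    unfolding generator_iff using compact_closure_even_layers negligible_even_layers_Int[OF assms] by blast
qed

text \<open>
  The set \<open>F (interior X)\<close> is open and dense in \<open>F X\<close>. Its intersection with \<open>U\<close> is open and null,
  hence empty, and an open set that misses a dense part of \<open>F X\<close> misses \<open>F X\<close>.
\<close>

lemma disjoint_of_negligible_Int:
  assumes "open U" "closure (interior X) = X" "negligible (U \<inter> F X)"
  shows "U \<inter> F X = {}"
proof -
  have "U \<inter> F (interior X) \<subseteq> U \<inter> F X"
    using hutchinson_mono[OF interior_subset] by blast
  then have "negligible (U \<inter> F (interior X))"
    using assms(3) negligible_subset by blast
  moreover have "open (U \<inter> F (interior X))"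
    using assms(1) by (intro open_Int open_hutchinson) auto
  ultimately have "U \<inter> F (interior X) = {}"
    using open_negligible_empty by blast
  then have "U \<inter> closure (F (interior X)) = {}"
    using assms(1) open_Int_closure_eq_empty by blast
  then show ?thesis
    using hutchinson_closure[of "interior X"] assms(2) by auto
qed

text \<open>
  Up to a null set \<open>F (F X)\<close> avoids \<open>F X\<close>, so it can only lie in the other part \<open>X\<close> of \<open>D\<close>.
  Passing to the open set \<open>F (F (interior X))\<close> removes the exceptional null set.
\<close>

lemma generator_twofold_invariant:
  assumes "dissection_generator k f D X"
  shows "(F ^^ 2) X \<subseteq> X"
proof -
  have X: "compact X" "closure (interior X) = X" "D = X \<union> F X" "negligible (X \<inter> F X)"
    using assms unfolding generator_iff by auto
  let ?U = "F (F (interior X))"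
  have U: "?U \<subseteq> F (F X)"
    by (intro hutchinson_mono interior_subset)
  have "negligible (F X \<inter> F (F X))"
    using X(3,4) by (intro negligible_hutchinson_Int) auto
  then have "negligible (?U \<inter> F X)"
    using U by (elim negligible_subset) blast
  then have "?U \<inter> F X = {}"
    using X(2) by (intro disjoint_of_negligible_Int open_hutchinson) auto
  moreover have "?U \<subseteq> D"
    using U X(3) inside hutchinson_mono[of "F X" D k f] by blast
  ultimately have "?U \<subseteq> X"
    using X(3) by blast
  then have "closure ?U \<subseteq> X"
    using X(1) by (intro closure_minimal compact_imp_closed)
  then show ?thesis
    using hutchinson_pow_closure[of 2 "interior X"] X(2) by (simp add: numeral_2_eq_2)
qed

text \<open>
  Since \<open>X\<close> is invariant under \<open>F ^^ 2\<close> it contains the attractor, and then so does \<open>F X\<close>; but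
  these two sets overlap in a null set only.
\<close>

lemma generator_negligible_attractor:
  assumes "dissection_generator k f D X"
  shows "negligible E"
proof -
  have X: "compact X" "D = X \<union> F X" "negligible (X \<inter> F X)"
    using assms unfolding generator_iff by auto
  have "X \<noteq> {}"
    using X(2) D_nonempty by (auto simp: hutchinson_def)
  then have "E \<subseteq> X"
    using X(1) generator_twofold_invariant[OF assms] by (intro attractor_subset[of X 2]) auto
  then have "E \<subseteq> F X"
    using hutchinson_mono[of E X k f] attractor by simp
  then show ?thesis
    using \<open>E \<subseteq> X\<close> X(3) negligible_subset by blast
qed

text \<open>
  The even layers lie in every generator \<open>X\<close>, because \<open>core\<close> does and \<open>F ^^ 2\<close> maps \<open>X\<close> into
  itself. Conversely \<open>interior X\<close> misses \<open>F X\<close>, hence the image of the even layers, and so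
  must be covered by the closure of the even layers themselves.
\<close>

lemma generator_unique:
  assumes "dissection_generator k f D X"
  shows "X = closure even_layers"
proof
  have X: "compact X" "closure (interior X) = X" "D = X \<union> F X" "negligible (X \<inter> F X)"
    using assms unfolding generator_iff by auto
  have "core \<subseteq> X"
    unfolding core_def using X(3) interior_subset[of D] hutchinson_mono[of X D k f] by blast
  then have "(F ^^ (2 * n)) core \<subseteq> X" for n
  proof (induction n)
    case (Suc n)
    then have "(F ^^ 2) ((F ^^ (2 * n)) core) \<subseteq> (F ^^ 2) X"
      by (intro hutchinson_pow_mono) auto
    then show ?case
      using generator_twofold_invariant[OF assms] by (simp add: numeral_2_eq_2)
  qed simp
  then show sub: "closure even_layers \<subseteq> X"
    unfolding even_layers_def using X(1) by (intro closure_minimal compact_imp_closed) blast+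
  have "negligible (interior X \<inter> F X)"
    using interior_subset[of X] by (intro negligible_subset[OF X(4)]) blast
  then have "interior X \<inter> F X = {}"
    using X(2) by (intro disjoint_of_negligible_Int) auto
  moreover have "interior X \<subseteq> closure even_layers \<union> F (closure even_layers)"
    using cover_even_layers[OF generator_negligible_attractor[OF assms]] X(3) interior_subset[of X]
    by blast
  ultimately have "interior X \<subseteq> closure even_layers"
    using hutchinson_mono[OF sub, of k f] by blast
  then show "X \<subseteq> closure even_layers"
    using closure_minimal[of "interior X" "closure even_layers"] X(2) by simp
qed

end

section \<open>The dissection theorem\<close>

theorem theorem2p2:
  fixes D E :: "(real^'n) set"
    and f :: "nat \<Rightarrow> real^'n \<Rightarrow> real^'n"
    and k :: nat
  assumes "compact D" and "D \<noteq> {}"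
    and "D = closure (interior D)"
    and "frontier D \<in> null_sets lebesgue"
    and "is_ifs k f"
    and "\<And>i. i \<in> {1..k} \<Longrightarrow> inj (f i)"
    and "is_attractor k f E"
    and "nonoverlapping_family k f D"
    and "inside_family k f D"
  shows "(admits_dissection k f D \<longleftrightarrow> E \<in> null_sets lebesgue) \<and>
         (\<forall>X Y. dissection_generator k f D X \<and> dissection_generator k f D Y \<longrightarrow> X = Y)"
proof -
  interpret nonoverlapping_inside_ifs k f D E
  proof
    show "closure (interior D) = D"
      using assms(3) by simp
    show "hutchinson k f D \<subseteq> D"
      using assms(9) unfolding inside_family_def hutchinson_def by blast
    show "hutchinson k f E = E" "compact E" "E \<noteq> {}"
      using assms(7) unfolding is_attractor_def hutchinson_def by simp_all
    show "contraction (f i)" if "i \<in> {1..k}" for i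
      using assms(5) that unfolding is_ifs_def by blast
    show "negligible (f i ` D \<inter> f j ` D)" if "i \<in> {1..k}" "j \<in> {1..k}" "i \<noteq> j" for i j
      using assms(8) that unfolding nonoverlapping_family_def negligible_iff_null_sets by blast
    show "negligible (frontier D)"
      using assms(4) unfolding negligible_iff_null_sets .
  qed (fact assms)+
  show ?thesis
    unfolding admits_dissection_def negligible_iff_null_sets[symmetric]
    using even_layers_generator generator_negligible_attractor generator_unique by metis
qed

end
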